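(* For all non-negative integers $n,k$, $\mathcal A_{n,k}=(-1)^{n-k}\mathcal A_{n,k}$; equivalently, $\mathcal A_{n,k}=0$ whenever $n-k$ is odd.
   Context: For non-negative integers $n,k$, define $\mathcal A_{n,k}:=\sum_{h\ge 0}B_h\binom{k+h-1}{h}{n\brack h+k}n^h$, where: $B_h$ are the Bernoulli numbers ($\frac{t}{e^t-1}=\sum_{h\ge0}B_h\frac{t^h}{h!}$, so $B_1=-\tfrac12$); ${n\brack m}$ is the unsigned Stirling number of the first kind, defined by $\sum_m{n\brack m}x^m=\prod_{j=0}^{n-1}(x+j)$ and vanishing for $m>n$; binomial coefficients $\binom{N}{h}$ for any integer $N$ are defined by $\sum_h\binom{N}{h}x^h=(1+x)^N$ (so $\binom{-1}{0}=1$ and $\binom{h-1}{h}=0$ for $h\ge1$); and $0^0=1$. *)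

theory Defs
  imports
    Complex_Main
    "HOL-Combinatorics.Stirling"
    "HOL-Computational_Algebra.Formal_Power_Series"
begin

definition bernoulli :: "nat \<Rightarrow> real" where
  "bernoulli h = fact h * fps_nth (fps_X / (fps_exp 1 - 1)) h"

text \<open>
  The sum over all \<open>h \<ge> 0\<close> is cut off at \<open>h = n\<close>, since the Stirling number vanishes for
  \<open>h + k > n\<close>; see \<open>A_sums\<close>. The upper entry \<open>k + h - 1\<close> of the binomial coefficient is an
  integer, equal to \<open>-1\<close> for \<open>k = h = 0\<close>.
\<close>

definition A_term :: "nat \<Rightarrow> nat \<Rightarrow> nat \<Rightarrow> real" where
  "A_term n k h =
     bernoulli h * (real_of_int (int k + int h - 1) gchoose h) * real (stirling n (h + k)) * real n ^ h"

definition A :: "nat \<Rightarrow> nat \<Rightarrow> real" where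
  "A n k = (\<Sum>h\<le>n. A_term n k h)"

lemma A_sums: "A_term n k sums A n k"
  unfolding A_def by (rule sums_finite) (auto simp: A_term_def)

lemma bernoulli_egf: "(fps_exp 1 - 1) * Abs_fps (\<lambda>h. bernoulli h / fact h) = fps_X"
proof -
  have "fps_nth (fps_exp 1 - 1 :: real fps) 1 \<noteq> 0"
    by simp
  then have nz: "fps_exp 1 - 1 \<noteq> (0 :: real fps)"
    by (metis fps_zero_nth)
  have "subdegree (fps_exp 1 - 1 :: real fps) \<le> 1"
    by (rule subdegree_leI) simp
  then have "fps_exp 1 - 1 dvd (fps_X :: real fps)"
    using nz by (simp add: fps_dvd_iff)
  moreover have "Abs_fps (\<lambda>h. bernoulli h / fact h) = fps_X / (fps_exp 1 - 1)"
    by (rule fps_ext) (simp add: bernoulli_def)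
  ultimately show ?thesis
    by simp
qed

lemma gchoose_top_zero: "real_of_int (int 0 + int h - 1) gchoose h = (if h = 0 then 1 else 0)"
proof (cases h)
  case (Suc m)
  then have "real_of_int (int 0 + int h - 1) gchoose h = real m gchoose Suc m"
    by simp
  also have "\<dots> = real (m choose Suc m)"
    by (simp only: binomial_gbinomial)
  finally show ?thesis
    using Suc by simp
qed simp

end

theory Submission
  imports Defs "HOL-Computational_Algebra.Polynomial"
begin

text \<open>
  For \<open>n \<ge> 1\<close> put \<open>Q(x) = (x + 1) \<cdots> (x + n - 1)\<close>, whose coefficients are the Stirling numbers
  \<open>stirling n (m + 1)\<close>. With \<open>D = d/dx\<close>, the number \<open>A n (m + 1)\<close> is the coefficient of \<open>x^m\<close> in
  \<open>R = (n D / (e^(n D) - 1)) Q\<close>. The roots of \<open>Q\<close> are symmetric about \<open>-n/2\<close>, so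
  \<open>Q(-x - n) = (-1)^(n - 1) Q(x)\<close>, while \<open>-t / (e^(-t) - 1) = e^t t / (e^t - 1)\<close> and \<open>e^(n D)\<close> is the
  shift by \<open>n\<close>. Together these give \<open>R(-x) = (-1)^(n - 1) R(x)\<close>.
\<close>

text \<open>Compare coefficients of \<open>t^s\<close> in \<open>F(-t) = e^t F(t)\<close>, where
  \<open>F(t) = t / (e^t - 1)\<close> is the exponential generating function of the Bernoulli
  numbers.\<close>

lemma bernoulli_reflect:
  "(\<Sum>h\<le>s. real (s choose h) * bernoulli h) = (-1) ^ s * bernoulli s"
proof -
  define F where "F = Abs_fps (\<lambda>h. bernoulli h / fact h)"
  define E :: "real fps" where "E = fps_exp 1"
  have egf: "(E - 1) * F = fps_X"
    unfolding F_def E_def by (rule bernoulli_egf)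
  have "fps_compose ((E - 1) * F) (- fps_X) = - fps_X"
    unfolding egf by simp
  then have neg: "(fps_exp (-1) - 1) * fps_compose F (- fps_X) = - fps_X"
    by (simp add: fps_compose_mult_distrib fps_compose_sub_distrib E_def)
  have inv: "E * fps_exp (-1) = 1"
    using fps_exp_add_mult[of "1 :: real" "-1"] by (simp add: E_def)
  have "(E - 1) * fps_compose F (- fps_X) = - (E * ((fps_exp (-1) - 1) * fps_compose F (- fps_X)))"
    using inv by (simp add: algebra_simps flip: mult.assoc)
  also have "\<dots> = (E - 1) * (F * E)"
    unfolding neg by (simp add: egf flip: mult.assoc)
  \<comment> \<open>The factor \<open>E - 1\<close> cancels: by \<open>egf\<close> it cannot be
    zero, as its product with \<open>F\<close> is \<open>fps_X\<close>.\<close>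
  finally have "fps_compose F (- fps_X) = F * E"
    using egf by auto
  then have "fps_nth (fps_compose F (- fps_X)) s = fps_nth (F * E) s"
    by (rule arg_cong)
  also have "\<dots> = (\<Sum>h\<le>s. bernoulli h / fact h * (1 / fact (s - h)))"
    by (simp add: F_def E_def fps_mult_nth atLeast0AtMost)
  finally have "(-1) ^ s * bernoulli s = fact s * (\<Sum>h\<le>s. bernoulli h / fact h * (1 / fact (s - h)))"
    by (simp add: fps_compose_uminus' F_def field_simps)
  also have "\<dots> = (\<Sum>h\<le>s. real (s choose h) * bernoulli h)"
    unfolding sum_distrib_left by (intro sum.cong) (auto simp: binomial_fact field_simps)
  finally show ?thesis ..
qed

text \<open>This is the rising factorial expansion divided by \<open>x\<close>, so the value at
  \<open>x = 0\<close> needs a separate argument.\<close>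

lemma stirling_Suc_pochhammer:
  fixes x :: real
  shows "(\<Sum>i\<le>n. real (stirling (Suc n) (Suc i)) * x ^ i) = pochhammer (x + 1) n"
proof (cases "x = 0")
  case True
  have "(\<Sum>i\<le>n. real (stirling (Suc n) (Suc i)) * x ^ i) = real (stirling (Suc n) (Suc 0))"
    using True by (subst sum.atMost_shift) simp
  also have "stirling (Suc n) (Suc 0) = fact n"
    by (rule stirling_Suc_n_1)
  finally show ?thesis
    using True by (simp del: stirling.simps flip: pochhammer_fact)
next
  case False
  have "x * (\<Sum>i\<le>n. real (stirling (Suc n) (Suc i)) * x ^ i) =
      (\<Sum>i\<le>Suc n. real (stirling (Suc n) i) * x ^ i)"
    unfolding sum_distrib_left
    by (subst sum.atMost_Suc_shift) (simp add: mult_ac del: stirling.simps(4))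
  also have "\<dots> = x * pochhammer (x + 1) n"
    by (simp only: stirling_pochhammer pochhammer_rec)
  finally show ?thesis
    using False by simp
qed

text \<open>With \<open>N = Suc n\<close>, this compares coefficients of \<open>x^m\<close> in
  \<open>Q(-x - N) = (-1)^n Q(x)\<close>. The generous bound \<open>Suc n\<close> on
  \<open>j\<close> matches the range of the sum in \<open>A\<close>.\<close>

lemma stirling_reflect:
  "(\<Sum>j\<le>Suc n. real (stirling (Suc n) (Suc (m + j))) * (-1) ^ (m + j) * real ((m + j) choose j)
      * real (Suc n) ^ j) = (-1) ^ n * real (stirling (Suc n) (Suc m))"
proof -
  define c where "c i = real (stirling (Suc n) (Suc i))" for i
  have c0: "c i = 0" if "i > n" for i
    using that by (simp add: c_def del: stirling.simps)
  define Q where "Q = (\<Sum>i\<le>n. monom (c i) i)"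
  \<comment> \<open>\<open>L\<close> is \<open>-x - N\<close>, so \<open>R\<close> is the
    composition of \<open>Q\<close> with \<open>L\<close>.\<close>
  define L :: "real poly" where "L = [:- real (Suc n), -1:]"
  define R where "R = (\<Sum>i\<le>n. smult (c i) (L ^ i))"
  have "poly R x = poly (smult ((-1) ^ n) Q) x" for x
  proof -
    have "poly L x = - x - real (Suc n)"
      by (simp add: L_def)
    then have "poly R x = (\<Sum>i\<le>n. c i * (- x - real (Suc n)) ^ i)"
      by (simp add: R_def poly_sum del: of_nat_Suc)
    also have "\<dots> = pochhammer (- (x + real n)) n"
      unfolding c_def stirling_Suc_pochhammer by (simp add: algebra_simps)
    also have "\<dots> = (-1) ^ n * pochhammer (x + 1) n"
      by (subst pochhammer_minus) simp
    also have "\<dots> = poly (smult ((-1) ^ n) Q) x"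
      by (simp add: Q_def poly_sum poly_monom c_def stirling_Suc_pochhammer del: stirling.simps)
    finally show ?thesis .
  qed
  then have "R = smult ((-1) ^ n) Q"
    using poly_eq_poly_eq_iff by blast
  then have "coeff R m = (-1) ^ n * coeff Q m"
    by simp
  also have "coeff Q m = c m"
    using c0[of m] by (auto simp: Q_def coeff_sum)
  finally have "(\<Sum>i\<le>n. c i * coeff (L ^ i) m) = (-1) ^ n * c m"
    by (simp add: R_def coeff_sum)
  \<comment> \<open>Substitute \<open>i = m + j\<close>. The unmatched terms vanish: for
    \<open>i < m\<close> the degree of \<open>L ^ i\<close> is too small, and for
    \<open>m + j > n\<close> the coefficient \<open>c\<close> is zero.\<close>
  moreover have "(\<Sum>j\<le>Suc n. c (m + j) * coeff (L ^ (m + j)) m) = (\<Sum>i\<le>n. c i * coeff (L ^ i) m)"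
  proof (rule sum.reindex_bij_witness_not_neutral
      [where S' = "{j. j \<le> Suc n \<and> n < m + j}" and T' = "{..<m}" and i = "\<lambda>i. i - m" and j = "\<lambda>j. m + j"])
    fix i assume "i \<in> {..<m}"
    then have "degree (L ^ i) < m"
      using degree_power_le[of L i] by (simp add: L_def)
    then show "c i * coeff (L ^ i) m = 0"
      by (simp add: coeff_eq_0)
  qed (auto simp: c0)
  moreover have "coeff (L ^ (m + j)) m = (-1) ^ (m + j) * real ((m + j) choose j) * real (Suc n) ^ j" for j
  proof -
    have "coeff (L ^ (m + j)) m = real ((m + j) choose m) * (-1) ^ m * (- real (Suc n)) ^ j"
      unfolding L_def by (subst coeff_linear_poly_power) auto
    also have "(- real (Suc n)) ^ j = (-1) ^ j * real (Suc n) ^ j"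
      by (rule power_minus)
    also have "(m + j) choose m = (m + j) choose j"
      by (subst binomial_symmetric) auto
    finally show ?thesis
      by (simp add: power_add)
  qed
  ultimately show ?thesis
    by (simp add: c_def mult.assoc del: stirling.simps of_nat_Suc)
qed

lemma A_Suc:
  "A n (Suc m) = (\<Sum>h\<le>n. bernoulli h * real ((m + h) choose h) * real (stirling n (Suc (m + h))) * real n ^ h)"
proof -
  have "real_of_int (int (Suc m) + int h - 1) gchoose h = real ((m + h) choose h)" for h
    by (simp add: binomial_gbinomial)
  then show ?thesis
    unfolding A_def A_term_def by (simp add: add.commute)
qed

text \<open>Expanding each Stirling number by \<open>stirling_reflect\<close> gives a double sum
  over \<open>h\<close> and \<open>j\<close>. Grouped by \<open>s = h + j\<close>, its inner sums
  collapse by \<open>bernoulli_reflect\<close>.\<close>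

lemma A_Suc_Suc_reflect: "(-1) ^ n * A (Suc n) (Suc m) = (-1) ^ m * A (Suc n) (Suc m)"
proof -
  define N where "N = Suc n"
  define c where "c i = real (stirling N (Suc i))" for i
  define g where "g h j = bernoulli h * real ((m + h) choose h) * real N ^ h *
      (c (m + h + j) * (-1) ^ (m + h + j) * real ((m + h + j) choose j) * real N ^ j)" for h j
  have c0: "c i = 0" if "i \<ge> N" for i
    using that by (simp add: c_def)
  have g0: "g h j = 0" if "h + j > N" for h j
    using that by (simp add: g_def c0)
  have "(-1) ^ n * A (Suc n) (Suc m) =
      (\<Sum>h\<le>N. bernoulli h * real ((m + h) choose h) * real N ^ h * ((-1) ^ n * c (m + h)))"
    unfolding A_Suc sum_distrib_left N_def c_def by (intro sum.cong) (auto simp: mult_ac)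
  also have "\<dots> = (\<Sum>h\<le>N. \<Sum>j\<le>N. g h j)"
    unfolding c_def N_def g_def stirling_reflect[symmetric] sum_distrib_left ..
  also have "\<dots> = (\<Sum>(h,j)\<in>{..N} \<times> {..N}. g h j)"
    by (rule sum.cartesian_product)
  also have "\<dots> = (\<Sum>(h,j)\<in>{(h,j). h + j \<le> N}. g h j)"
    by (rule sum.mono_neutral_right) (auto intro: g0 simp flip: not_le)
  also have "\<dots> = (\<Sum>s\<le>N. \<Sum>h\<le>s. g h (s - h))"
    by (rule sum.triangle_reindex_eq)
  also have "\<dots> = (\<Sum>s\<le>N. (-1) ^ m * (bernoulli s * real ((m + s) choose s) * c (m + s) * real N ^ s))"
  proof (rule sum.cong)
    fix s assume "s \<in> {..N}"
    \<comment> \<open>\<open>d\<close> gathers the factors that do not depend on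
      \<open>h\<close>.\<close>
    define d where "d = real N ^ s * c (m + s) * (-1) ^ (m + s) * real ((m + s) choose s)"
    have "g h (s - h) = d * (real (s choose h) * bernoulli h)" if "h \<le> s" for h
    proof -
      \<comment> \<open>Both sides are the multinomial coefficient
        \<open>(m + s)! / (m! h! (s - h)!)\<close>.\<close>
      have "((m + h) choose h) * ((m + s) choose (s - h)) = ((m + s) choose s) * (s choose h)"
        using that choose_mult[of h s "m + s"] choose_mult[of "s - h" s "m + s"]
          binomial_symmetric[OF that]
        by (simp add: mult.commute)
      then have "real ((m + h) choose h) * real ((m + s) choose (s - h)) =
          real ((m + s) choose s) * real (s choose h)"
        by (metis of_nat_mult)
      moreover have "real N ^ h * real N ^ (s - h) = real N ^ s"
        using that by (simp flip: power_add)
      moreover have "g h (s - h) = bernoulli h * c (m + s) * (-1) ^ (m + s) *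
          (real ((m + h) choose h) * real ((m + s) choose (s - h))) * (real N ^ h * real N ^ (s - h))"
        using that by (simp add: g_def mult_ac)
      ultimately show ?thesis
        by (simp add: d_def mult_ac)
    qed
    then have "(\<Sum>h\<le>s. g h (s - h)) = d * ((-1) ^ s * bernoulli s)"
      by (simp add: sum_distrib_left flip: bernoulli_reflect)
    also have "\<dots> = (-1) ^ m * (bernoulli s * real ((m + s) choose s) * c (m + s) * real N ^ s)"
      by (simp add: d_def power_add mult_ac flip: power_mult_distrib)
    finally show "(\<Sum>h\<le>s. g h (s - h)) =
        (-1) ^ m * (bernoulli s * real ((m + s) choose s) * c (m + s) * real N ^ s)" .
  qed simp
  also have "\<dots> = (-1) ^ m * A (Suc n) (Suc m)"
    unfolding A_Suc sum_distrib_left N_def c_def ..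
  finally show ?thesis .
qed

lemma A_eq_0_if_odd:
  assumes "odd (n + k)"
  shows "A n k = 0"
proof (cases "n = 0 \<or> k = 0")
  case True
  with assms show ?thesis
    \<comment> \<open>All terms vanish: for \<open>k = 0\<close> the binomial leaves only
      \<open>h = 0\<close>, where \<open>stirling n 0 = 0\<close> as \<open>n\<close> is odd; for
      \<open>n = 0\<close> the Stirling numbers are zero since \<open>k > 0\<close>.\<close>
    by (cases n; cases k) (auto simp: A_def A_term_def gchoose_top_zero[simplified] intro!: sum.neutral)
next
  case False
  then obtain n' m where [simp]: "n = Suc n'" "k = Suc m"
    by (metis not0_implies_Suc)
  from assms have "odd (n' + m)"
    by simp
  \<comment> \<open>The two signs are opposite, so the value equals its own negative.\<close>
  with A_Suc_Suc_reflect[of n' m] show ?thesis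
    by (cases "even m") auto
qed

theorem theorem5p1:
  fixes n k :: nat
  shows "A n k = (-1) powi (int n - int k) * A n k \<and>
         (odd (int n - int k) \<longrightarrow> A n k = 0)"
proof (cases "odd (n + k)")
  case True
  then show ?thesis
    by (simp add: A_eq_0_if_odd)
next
  case False
  then have "even (int n - int k)"
    by simp
  then show ?thesis
    by (simp add: power_int_minus_left)
qed

end
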